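(* Let $p \geq 1$ be an integer. For any pair of vectors $\mathbf{x},\mathbf{y} \in \mathbb{R}^n$, we have \[ \| \mathbf{x}^p \|\| \mathbf{y}^p \| - |\langle \mathbf{x}^p,\mathbf{y}^p\rangle| \leq \|\mathbf{x}\|^{p}\|\mathbf{y}\|^{p} - |\langle \mathbf{x},\mathbf{y}\rangle|^{p}. \]
   Context: For a vector $\mathbf{x}=(x_1,\ldots,x_n)\in\mathbb{R}^n$, $\mathbf{x}^p=(x_1^p,\ldots,x_n^p)$ is the entrywise $p$-th power. $\langle\cdot,\cdot\rangle$ and $\|\cdot\|$ are the usual dot product and Euclidean norm on $\mathbb{R}^n$. *)

theory Defs
  imports "HOL-Analysis.Analysis"
begin

definition entrywise_power :: "real ^ 'n \<Rightarrow> nat \<Rightarrow> real ^ 'n"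
  where "entrywise_power x p = (\<chi> i. (x $ i) ^ p)"

end

theory Submission
  imports Defs
begin

text \<open>
  The gap $\|u\|\,\|v\| - |\langle u, v\rangle|$ in the Cauchy--Schwarz inequality cannot grow
  when both vectors are restricted to a subset of their coordinates
  (\<open>Cauchy_Schwarz_gap_mono\<close>). The theorem is an instance of this for tensor powers.
  The $p$-fold tensor power of \<open>x\<close> has the coordinate $\prod_{k<p} x_{g(k)}$ at the index tuple
  $g$; its inner product with the tensor power of \<open>y\<close> is $\langle x, y\rangle^p$, hence its
  norm is $\|x\|^p$ (\<open>inner_power_eq_sum_tuples\<close>). On the diagonal, that is at the constant
  tuples, the coordinates are the $x_i^p$, so the restriction to the diagonal is the entrywise
  power, and the two gaps compared are the two sides of the claimed inequality.
\<close>

text \<open>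
  Splitting the inner product along \<open>A = B \<union> (A - B)\<close> and applying Cauchy--Schwarz to the part
  outside \<open>B\<close> bounds the growth of the inner product by the product of the norms outside \<open>B\<close>. By
  Cauchy--Schwarz in the plane, for the pairs of norms inside and outside \<open>B\<close>, the product of
  the full norms grows at least as much.
\<close>

lemma Cauchy_Schwarz_gap_mono:
  fixes u v :: "'a \<Rightarrow> real"
  assumes "finite A" and "B \<subseteq> A"
  shows "L2_set u B * L2_set v B - \<bar>\<Sum>i\<in>B. u i * v i\<bar>
           \<le> L2_set u A * L2_set v A - \<bar>\<Sum>i\<in>A. u i * v i\<bar>"
proof -
  let ?C = "A - B"
  have split: "(\<Sum>i\<in>A. f i) = (\<Sum>i\<in>?C. f i) + (\<Sum>i\<in>B. f i)" for f :: "'a \<Rightarrow> real"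
    using assms by (rule sum.subset_diff[rotated])
  have pythagoras: "norm (L2_set f B, L2_set f ?C) = L2_set f A" for f :: "'a \<Rightarrow> real"
    by (simp add: norm_Pair L2_set_def sum_nonneg split[of "\<lambda>i. (f i)\<^sup>2"] add.commute)
  have "\<bar>\<Sum>i\<in>?C. u i * v i\<bar> \<le> (\<Sum>i\<in>?C. \<bar>u i\<bar> * \<bar>v i\<bar>)"
    using sum_abs[of "\<lambda>i. u i * v i" ?C] by (simp add: abs_mult)
  also have "\<dots> \<le> L2_set u ?C * L2_set v ?C"
    by (rule L2_set_mult_ineq)
  finally have outside: "\<bar>\<Sum>i\<in>?C. u i * v i\<bar> \<le> L2_set u ?C * L2_set v ?C" .
  have "(L2_set u B, L2_set u ?C) \<bullet> (L2_set v B, L2_set v ?C) \<le> L2_set u A * L2_set v A"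
    using norm_cauchy_schwarz[of "(L2_set u B, L2_set u ?C)" "(L2_set v B, L2_set v ?C)"]
    by (simp only: pythagoras)
  hence "L2_set u B * L2_set v B + L2_set u ?C * L2_set v ?C \<le> L2_set u A * L2_set v A"
    by simp
  with outside split[of "\<lambda>i. u i * v i"] show ?thesis
    by linarith
qed

text \<open>
  Expanding the \<open>p\<close>-th power of the sum defining the inner product produces one term for each
  tuple of \<open>p\<close> indices.
\<close>

lemma inner_power_eq_sum_tuples:
  fixes x y :: "real ^ 'n"
  shows "(x \<bullet> y) ^ p
           = (\<Sum>g\<in>{..<p} \<rightarrow>\<^sub>E UNIV. (\<Prod>k<p. x $ g k) * (\<Prod>k<p. y $ g k))"
proof -
  have "(x \<bullet> y) ^ p = (\<Prod>k<p. \<Sum>i\<in>UNIV. x $ i * y $ i)"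
    by (simp add: inner_vec_def)
  also have "\<dots> = (\<Sum>g\<in>{..<p} \<rightarrow>\<^sub>E UNIV. \<Prod>k<p. x $ g k * y $ g k)"
    by (rule prod_sum_PiE) auto
  finally show ?thesis
    by (simp add: prod.distrib)
qed

lemma norm_power_eq_L2_set_tuples:
  fixes x :: "real ^ 'n"
  shows "norm x ^ p = L2_set (\<lambda>g. \<Prod>k<p. x $ g k) ({..<p} \<rightarrow>\<^sub>E UNIV)"
proof -
  have "norm x ^ p = sqrt ((x \<bullet> x) ^ p)"
    by (simp add: norm_eq_sqrt_inner real_sqrt_power)
  thus ?thesis
    by (simp add: inner_power_eq_sum_tuples L2_set_def power2_eq_square)
qed

theorem corollary3p4:
  fixes x y :: "real ^ 'n" and p :: nat
  assumes "p \<ge> 1"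
  shows "norm (entrywise_power x p) * norm (entrywise_power y p)
           - \<bar>entrywise_power x p \<bullet> entrywise_power y p\<bar>
         \<le> norm x ^ p * norm y ^ p - \<bar>x \<bullet> y\<bar> ^ p"
proof -
  define T where "T = ({..<p} \<rightarrow>\<^sub>E UNIV :: (nat \<Rightarrow> 'n) set)"
  define diag where "diag i = (\<lambda>k\<in>{..<p}. i)" for i :: 'n
  define tensor where "tensor z g = (\<Prod>k<p. z $ g k)" for z :: "real ^ 'n" and g
  have "finite T"
    by (simp add: T_def finite_PiE)
  have "range diag \<subseteq> T"
    by (auto simp: T_def diag_def split: if_splits)
  \<comment> \<open>For \<open>p = 0\<close> all diagonal tuples would coincide with the empty one.\<close>
  have "inj diag"
  proof (rule injI)
    fix i j assume "diag i = diag j"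
    hence "diag i 0 = diag j 0" by simp
    thus "i = j" using assms by (simp add: diag_def)
  qed
  have tensor_diag: "tensor z (diag i) = (z $ i) ^ p" for z i
    by (simp add: tensor_def diag_def)
  have norm_diag: "L2_set (tensor z) (range diag) = norm (entrywise_power z p)" for z
    using \<open>inj diag\<close>
    by (simp add: L2_set_def norm_vec_def sum.reindex tensor_diag entrywise_power_def)
  have inner_diag: "(\<Sum>g\<in>range diag. tensor x g * tensor y g)
      = entrywise_power x p \<bullet> entrywise_power y p"
    using \<open>inj diag\<close>
    by (simp add: inner_vec_def sum.reindex tensor_diag entrywise_power_def)
  have norm_T: "L2_set (tensor z) T = norm z ^ p" for z
    by (simp add: norm_power_eq_L2_set_tuples T_def tensor_def[abs_def])
  have inner_T: "(\<Sum>g\<in>T. tensor x g * tensor y g) = (x \<bullet> y) ^ p"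
    by (simp add: inner_power_eq_sum_tuples T_def tensor_def)
  show ?thesis
    using Cauchy_Schwarz_gap_mono[OF \<open>finite T\<close> \<open>range diag \<subseteq> T\<close>, of "tensor x" "tensor y"]
    by (simp only: norm_diag inner_diag norm_T inner_T power_abs)
qed

end
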